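(* Let $S$ be a $\Gamma$-semigroup, let $\gamma_0 \in \Gamma$ be a fixed element, and let $\Sigma$ be the universal semigroup of $S$ (with respect to $\gamma_0$). For every $x \in S$, the left ideal of $\Sigma$ generated by $x$ is the set $$(x)_{\ell}^{\Sigma} = (x)_{\ell}^{\Gamma} \cup \Gamma (x)_{\ell}^{\Gamma},$$ where $(x)_{\ell}^{\Gamma} = S\Gamma x \cup \{x\}$ is the left ideal of the $\Gamma$-semigroup $S$ generated by $x$, and $\Gamma (x)_{\ell}^{\Gamma} = \{\gamma y : \gamma \in \Gamma,\ y \in (x)_{\ell}^{\Gamma}\} \subseteq \Sigma$.
   Context: Let $S$ and $\Gamma$ be non-empty sets. A $\Gamma$-semigroup is a set $S$ together with a map $S \times \Gamma \times S \to S$, $(a,\gamma,b) \mapsto a\gamma b$, such that $(a\alpha b)\beta c = a\alpha(b\beta c)$ for all $a,b,c \in S$ and $\alpha,\beta \in \Gamma$. A left ideal of the $\Gamma$-semigroup $S$ is a non-empty subset $L \subseteq S$ with $s\gamma a \in L$ for all $s \in S$, $\gamma \in \Gamma$, $a \in L$. Write $S\Gamma x = \{s\gamma x : s \in S,\ \gamma \in \Gamma\}$. The universal semigroup $\Sigma$ of $S$ (with respect to a fixed $\gamma_0 \in \Gamma$) is the quotient of the free semigroup $F$ on the disjoint union $S \cup \Gamma$ by the congruence generated by the relations $(\gamma_1,\gamma_2) \sim \gamma_1$, $(x,\gamma,y) \sim x\gamma y$, and $(x,y) \sim x\gamma_0 y$, for all $\gamma_1,\gamma_2,\gamma \in \Gamma$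 and $x,y \in S$; here $(u_1,\dots,u_n)$ denotes a word in $F$ with letters $u_1,\dots,u_n$, and $x\gamma y$, $x\gamma_0 y$ on the right-hand sides are single letters in $S$. The canonical map $F \to \Sigma$ is injective on $S$ and on $\Gamma$, and elements of $S$ and $\Gamma$ are identified with their images in $\Sigma$. For $\gamma \in \Gamma$ and $y \in S$, $\gamma y \in \Sigma$ denotes the product in $\Sigma$ of $\gamma$ and $y$. *)

theory Defs
  imports Main
begin

section \<open>Gamma-semigroups\<close>

locale gamma_semigroup =
  fixes S :: "'s set" and \<Gamma> :: "'g set" and act :: "'s \<Rightarrow> 'g \<Rightarrow> 's \<Rightarrow> 's"
  assumes S_nonempty: "S \<noteq> {}"
    and Gamma_nonempty: "\<Gamma> \<noteq> {}"
    and act_closed: "\<lbrakk>a \<in> S; \<gamma> \<in> \<Gamma>; b \<in> S\<rbrakk> \<Longrightarrow> act a \<gamma> b \<in> S"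
    and act_assoc: "\<lbrakk>a \<in> S; b \<in> S; c \<in> S; \<alpha> \<in> \<Gamma>; \<beta> \<in> \<Gamma>\<rbrakk> \<Longrightarrow>
      act (act a \<alpha> b) \<beta> c = act a \<alpha> (act b \<beta> c)"

definition gamma_left_ideal ::
    "'s set \<Rightarrow> 'g set \<Rightarrow> ('s \<Rightarrow> 'g \<Rightarrow> 's \<Rightarrow> 's) \<Rightarrow> 's set \<Rightarrow> bool" where
  "gamma_left_ideal S \<Gamma> act L \<longleftrightarrow>
     L \<noteq> {} \<and> L \<subseteq> S \<and> (\<forall>s\<in>S. \<forall>\<gamma>\<in>\<Gamma>. \<forall>a\<in>L. act s \<gamma> a \<in> L)"

definition gamma_left_ideal_gen ::
    "'s set \<Rightarrow> 'g set \<Rightarrow> ('s \<Rightarrow> 'g \<Rightarrow> 's \<Rightarrow> 's) \<Rightarrow> 's \<Rightarrow> 's set" where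
  "gamma_left_ideal_gen S \<Gamma> act x = \<Inter>{L. gamma_left_ideal S \<Gamma> act L \<and> x \<in> L}"


section \<open>Semigroups on a carrier set\<close>

definition left_ideal :: "'a set \<Rightarrow> ('a \<Rightarrow> 'a \<Rightarrow> 'a) \<Rightarrow> 'a set \<Rightarrow> bool" where
  "left_ideal A f L \<longleftrightarrow> L \<noteq> {} \<and> L \<subseteq> A \<and> (\<forall>s\<in>A. \<forall>a\<in>L. f s a \<in> L)"

definition left_ideal_gen :: "'a set \<Rightarrow> ('a \<Rightarrow> 'a \<Rightarrow> 'a) \<Rightarrow> 'a \<Rightarrow> 'a set" where
  "left_ideal_gen A f x = \<Inter>{L. left_ideal A f L \<and> x \<in> L}"

definition semigroup_congruence :: "'a set \<Rightarrow> ('a \<Rightarrow> 'a \<Rightarrow> 'a) \<Rightarrow> ('a \<times> 'a) set \<Rightarrow> bool" where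
  "semigroup_congruence A f r \<longleftrightarrow>
     r \<subseteq> A \<times> A \<and> equiv A r \<and>
     (\<forall>a b c d. (a, b) \<in> r \<longrightarrow> (c, d) \<in> r \<longrightarrow> (f a c, f b d) \<in> r)"

definition congruence_gen ::
    "'a set \<Rightarrow> ('a \<Rightarrow> 'a \<Rightarrow> 'a) \<Rightarrow> ('a \<times> 'a) set \<Rightarrow> ('a \<times> 'a) set" where
  "congruence_gen A f R = \<Inter>{r. semigroup_congruence A f r \<and> R \<subseteq> r}"

definition free_semigroup :: "'a set \<Rightarrow> 'a list set" where
  "free_semigroup X = lists X - {[]}"


section \<open>The universal semigroup of a Gamma-semigroup\<close>

text \<open>Letters are tagged by the sum type: \<^term>\<open>Inl x\<close> for \<open>x \<in> S\<close> and
  \<^term>\<open>Inr \<gamma>\<close> for \<open>\<gamma> \<in> \<Gamma>\<close>.\<close>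

definition universal_relations ::
    "'s set \<Rightarrow> 'g set \<Rightarrow> ('s \<Rightarrow> 'g \<Rightarrow> 's \<Rightarrow> 's) \<Rightarrow> 'g \<Rightarrow> (('s + 'g) list \<times> ('s + 'g) list) set" where
  "universal_relations S \<Gamma> act \<gamma>0 =
     {([Inr \<gamma>1, Inr \<gamma>2], [Inr \<gamma>1]) | \<gamma>1 \<gamma>2. \<gamma>1 \<in> \<Gamma> \<and> \<gamma>2 \<in> \<Gamma>}
   \<union> {([Inl x, Inr \<gamma>, Inl y], [Inl (act x \<gamma> y)]) | x \<gamma> y. x \<in> S \<and> \<gamma> \<in> \<Gamma> \<and> y \<in> S}
   \<union> {([Inl x, Inl y], [Inl (act x \<gamma>0 y)]) | x y. x \<in> S \<and> y \<in> S}"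

definition universal_cong ::
    "'s set \<Rightarrow> 'g set \<Rightarrow> ('s \<Rightarrow> 'g \<Rightarrow> 's \<Rightarrow> 's) \<Rightarrow> 'g \<Rightarrow> (('s + 'g) list \<times> ('s + 'g) list) set" where
  "universal_cong S \<Gamma> act \<gamma>0 =
     congruence_gen (free_semigroup (S <+> \<Gamma>)) (@) (universal_relations S \<Gamma> act \<gamma>0)"

definition universal_semigroup ::
    "'s set \<Rightarrow> 'g set \<Rightarrow> ('s \<Rightarrow> 'g \<Rightarrow> 's \<Rightarrow> 's) \<Rightarrow> 'g \<Rightarrow> ('s + 'g) list set set" where
  "universal_semigroup S \<Gamma> act \<gamma>0 = free_semigroup (S <+> \<Gamma>) // universal_cong S \<Gamma> act \<gamma>0"

definition universal_mult ::
    "'s set \<Rightarrow> 'g set \<Rightarrow> ('s \<Rightarrow> 'g \<Rightarrow> 's \<Rightarrow> 's) \<Rightarrow> 'g \<Rightarrow>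
     ('s + 'g) list set \<Rightarrow> ('s + 'g) list set \<Rightarrow> ('s + 'g) list set" where
  "universal_mult S \<Gamma> act \<gamma>0 X Y = (\<Union>u\<in>X. \<Union>v\<in>Y. universal_cong S \<Gamma> act \<gamma>0 `` {u @ v})"

definition universal_S ::
    "'s set \<Rightarrow> 'g set \<Rightarrow> ('s \<Rightarrow> 'g \<Rightarrow> 's \<Rightarrow> 's) \<Rightarrow> 'g \<Rightarrow> 's \<Rightarrow> ('s + 'g) list set" where
  "universal_S S \<Gamma> act \<gamma>0 x = universal_cong S \<Gamma> act \<gamma>0 `` {[Inl x]}"

definition universal_Gamma ::
    "'s set \<Rightarrow> 'g set \<Rightarrow> ('s \<Rightarrow> 'g \<Rightarrow> 's \<Rightarrow> 's) \<Rightarrow> 'g \<Rightarrow> 'g \<Rightarrow> ('s + 'g) list set" where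
  "universal_Gamma S \<Gamma> act \<gamma>0 \<gamma> = universal_cong S \<Gamma> act \<gamma>0 `` {[Inr \<gamma>]}"

lemma semigroup_congruence_gen:
  assumes R: "R \<subseteq> A \<times> A" and f: "\<And>a b. \<lbrakk>a \<in> A; b \<in> A\<rbrakk> \<Longrightarrow> f a b \<in> A"
  shows "semigroup_congruence A f (congruence_gen A f R)"
proof -
  define C where "C = {r. semigroup_congruence A f r \<and> R \<subseteq> r}"
  have C: "r \<subseteq> A \<times> A" "refl_on A r" "sym r" "trans r"
      "\<And>a b c d. \<lbrakk>(a, b) \<in> r; (c, d) \<in> r\<rbrakk> \<Longrightarrow> (f a c, f b d) \<in> r" if "r \<in> C" for r
    using that unfolding C_def semigroup_congruence_def equiv_def by simp_all
  have "A \<times> A \<in> C"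
    using R f by (simp add: C_def semigroup_congruence_def equiv_def refl_on_def sym_def trans_def)
  then have "\<Inter>C \<subseteq> A \<times> A"
    by (rule Inter_lower)
  moreover have "refl_on A (\<Inter>C)"
    using C(2) by (simp add: refl_on_def)
  moreover have "sym (\<Inter>C)"
    using C(3) by (auto intro!: symI dest: symD)
  moreover have "trans (\<Inter>C)"
    by (rule transI) (meson C(4) InterE InterI transD)
  moreover have "(f a c, f b d) \<in> \<Inter>C" if "(a, b) \<in> \<Inter>C" "(c, d) \<in> \<Inter>C" for a b c d
    using that C(5) by simp
  ultimately have "semigroup_congruence A f (\<Inter>C)"
    unfolding semigroup_congruence_def equiv_def by blast
  then show ?thesis
    by (simp only: congruence_gen_def C_def)
qed

context gamma_semigroup
begin

lemma semigroup_congruence_universal_cong: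
  assumes "\<gamma>0 \<in> \<Gamma>"
  shows "semigroup_congruence (free_semigroup (S <+> \<Gamma>)) (@) (universal_cong S \<Gamma> act \<gamma>0)"
  unfolding universal_cong_def
proof (rule semigroup_congruence_gen)
  show "universal_relations S \<Gamma> act \<gamma>0 \<subseteq> free_semigroup (S <+> \<Gamma>) \<times> free_semigroup (S <+> \<Gamma>)"
    using assms by (auto simp: universal_relations_def free_semigroup_def act_closed)
qed (auto simp: free_semigroup_def)

lemma universal_mult_class:
  assumes "\<gamma>0 \<in> \<Gamma>" "u \<in> free_semigroup (S <+> \<Gamma>)" "v \<in> free_semigroup (S <+> \<Gamma>)"
  shows "universal_mult S \<Gamma> act \<gamma>0
           (universal_cong S \<Gamma> act \<gamma>0 `` {u}) (universal_cong S \<Gamma> act \<gamma>0 `` {v})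
         = universal_cong S \<Gamma> act \<gamma>0 `` {u @ v}"
proof -
  let ?A = "free_semigroup (S <+> \<Gamma>)" and ?r = "universal_cong S \<Gamma> act \<gamma>0"
  have c: "equiv ?A ?r" "\<And>a b c d. \<lbrakk>(a, b) \<in> ?r; (c, d) \<in> ?r\<rbrakk> \<Longrightarrow> (a @ c, b @ d) \<in> ?r"
    using semigroup_congruence_universal_cong[OF assms(1)]
    unfolding semigroup_congruence_def by blast+
  have "congruent2 ?r ?r (\<lambda>u v. ?r `` {u @ v})"
    by (rule congruent2I') (auto intro!: equiv_class_eq[OF c(1)] c(2))
  then show ?thesis
    unfolding universal_mult_def using UN_equiv_class2[OF c(1) c(1)] assms(2,3) by blast
qed

end

end

theory Submission
  imports Defs
begin

text \<open>Modulo the defining relations, multiplying a word \<open>y\<close> or \<open>\<gamma> y\<close> (with \<open>y\<close> in a left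
  \<open>\<Gamma>\<close>-ideal \<open>L\<close>) on the left by a single letter gives again a word of this shape:
  \<open>s y = s \<gamma>0 y\<close>, \<open>s (\<gamma> y) = s \<gamma> y\<close> and \<open>\<gamma> (\<gamma>' y) = \<gamma> y\<close>. Induction on the length of the
  multiplier then shows that \<open>L \<union> \<Gamma> L\<close> is a left ideal of \<open>\<Sigma>\<close>. Conversely a left ideal of \<open>\<Sigma>\<close>
  containing \<open>x\<close> contains \<open>s \<gamma> x\<close>, the product of the word \<open>(s, \<gamma>)\<close> with \<open>x\<close>.\<close>

lemma congruence_gen_contains: "R \<subseteq> congruence_gen A f R"
  unfolding congruence_gen_def by blast

lemma left_ideal_gen_eqI:
  assumes "left_ideal A f L" "x \<in> L"
    and "\<And>M. \<lbrakk>left_ideal A f M; x \<in> M\<rbrakk> \<Longrightarrow> L \<subseteq> M"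
  shows "left_ideal_gen A f x = L"
  unfolding left_ideal_gen_def using assms by (intro antisym Inter_lower Inter_greatest) blast+

context gamma_semigroup
begin

text \<open>Associativity gives \<open>t \<beta> (s \<gamma> x) = (t \<beta> s) \<gamma> x\<close>,
  so a product with an element of \<open>S \<Gamma> x\<close> again has this form, with witnesses
  \<open>t \<beta> s\<close> and \<open>\<gamma>\<close>.\<close>

lemma gamma_left_ideal_principal:
  assumes "x \<in> S"
  shows "gamma_left_ideal S \<Gamma> act ({act s \<gamma> x | s \<gamma>. s \<in> S \<and> \<gamma> \<in> \<Gamma>} \<union> {x})"
proof -
  have "\<exists>s' \<gamma>'. act t \<beta> (act s \<gamma> x) = act s' \<gamma>' x \<and> s' \<in> S \<and> \<gamma>' \<in> \<Gamma>"
    if "t \<in> S" "\<beta> \<in> \<Gamma>" "s \<in> S" "\<gamma> \<in> \<Gamma>" for t \<beta> s \<gamma>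
    using that assms act_assoc[of t s x \<beta> \<gamma>] act_closed[of t \<beta> s] by metis
  then show ?thesis
    using assms by (auto simp: gamma_left_ideal_def act_closed)
qed

lemma gamma_left_ideal_gen_eq:
  assumes "x \<in> S"
  shows "gamma_left_ideal_gen S \<Gamma> act x = {act s \<gamma> x | s \<gamma>. s \<in> S \<and> \<gamma> \<in> \<Gamma>} \<union> {x}"
  unfolding gamma_left_ideal_gen_def
proof (intro antisym Inter_lower Inter_greatest)
  fix L assume "L \<in> {L. gamma_left_ideal S \<Gamma> act L \<and> x \<in> L}"
  then show "{act s \<gamma> x | s \<gamma>. s \<in> S \<and> \<gamma> \<in> \<Gamma>} \<union> {x} \<subseteq> L"
    by (auto simp: gamma_left_ideal_def)
qed (use gamma_left_ideal_principal[OF assms] in simp)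

text \<open>A congruence allows a defining relation to be applied to a prefix of a word. Prefixes
  suffice below: multipliers act from the left, one letter at a time, so each rewriting happens at
  the front.\<close>

lemma universal_class_eq:
  assumes "\<gamma>0 \<in> \<Gamma>" and "(u, v) \<in> universal_relations S \<Gamma> act \<gamma>0"
    and "w \<in> lists (S <+> \<Gamma>)"
  shows "universal_cong S \<Gamma> act \<gamma>0 `` {u @ w} = universal_cong S \<Gamma> act \<gamma>0 `` {v @ w}"
proof -
  let ?A = "free_semigroup (S <+> \<Gamma>)" and ?r = "universal_cong S \<Gamma> act \<gamma>0"
  have c: "equiv ?A ?r" "\<And>a b c d. \<lbrakk>(a, b) \<in> ?r; (c, d) \<in> ?r\<rbrakk> \<Longrightarrow> (a @ c, b @ d) \<in> ?r"
    using semigroup_congruence_universal_cong[OF assms(1)]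
    unfolding semigroup_congruence_def by blast+
  have uv: "(u, v) \<in> ?r"
    using assms(2) congruence_gen_contains unfolding universal_cong_def by blast
  have "(u @ w, v @ w) \<in> ?r"
  \<comment> \<open>The empty word is not in the free semigroup, so reflexivity gives
    \<open>(w, w)\<close> only for non-empty \<open>w\<close>; for empty \<open>w\<close> the claim
    is the relation itself.\<close>
  proof (cases "w = []")
    case False
    then have "(w, w) \<in> ?r"
      using assms(3) c(1) by (simp add: free_semigroup_def equiv_def refl_on_def)
    then show ?thesis using c(2)[OF uv] by blast
  qed (simp add: uv)
  then show ?thesis by (rule equiv_class_eq[OF c(1)])
qed

lemma universal_class_Gamma_Gamma:
  assumes "\<gamma>0 \<in> \<Gamma>" "\<alpha> \<in> \<Gamma>" "\<beta> \<in> \<Gamma>" "w \<in> lists (S <+> \<Gamma>)"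
  shows "universal_cong S \<Gamma> act \<gamma>0 `` {Inr \<alpha> # Inr \<beta> # w}
    = universal_cong S \<Gamma> act \<gamma>0 `` {Inr \<alpha> # w}"
  using assms universal_class_eq[of \<gamma>0 "[Inr \<alpha>, Inr \<beta>]" "[Inr \<alpha>]" w]
  by (simp add: universal_relations_def)

lemma universal_class_S_Gamma_S:
  assumes "\<gamma>0 \<in> \<Gamma>" "s \<in> S" "\<gamma> \<in> \<Gamma>" "y \<in> S"
  shows "universal_cong S \<Gamma> act \<gamma>0 `` {[Inl s, Inr \<gamma>, Inl y]}
    = universal_S S \<Gamma> act \<gamma>0 (act s \<gamma> y)"
  using assms universal_class_eq[of \<gamma>0 "[Inl s, Inr \<gamma>, Inl y]" "[Inl (act s \<gamma> y)]" "[]"]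
  by (auto simp: universal_relations_def universal_S_def)

lemma universal_class_S_S:
  assumes "\<gamma>0 \<in> \<Gamma>" "s \<in> S" "y \<in> S"
  shows "universal_cong S \<Gamma> act \<gamma>0 `` {[Inl s, Inl y]}
    = universal_S S \<Gamma> act \<gamma>0 (act s \<gamma>0 y)"
  using assms universal_class_eq[of \<gamma>0 "[Inl s, Inl y]" "[Inl (act s \<gamma>0 y)]" "[]"]
  by (auto simp: universal_relations_def universal_S_def)

text \<open>Only closure of \<open>L\<close> under the action matters, so \<open>L\<close> may be
  any left ideal of the \<Gamma>-semigroup. The argument runs on representing words instead of
  classes.\<close>

lemma left_ideal_universal:
  assumes g0: "\<gamma>0 \<in> \<Gamma>" and L: "gamma_left_ideal S \<Gamma> act L"
  shows "left_ideal (universal_semigroup S \<Gamma> act \<gamma>0) (universal_mult S \<Gamma> act \<gamma>0)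
    (universal_S S \<Gamma> act \<gamma>0 ` L
      \<union> {universal_mult S \<Gamma> act \<gamma>0 (universal_Gamma S \<Gamma> act \<gamma>0 \<gamma>) (universal_S S \<Gamma> act \<gamma>0 y) | \<gamma> y.
           \<gamma> \<in> \<Gamma> \<and> y \<in> L})" (is "left_ideal ?\<Sigma> ?m ?T")
proof -
  let ?A = "free_semigroup (S <+> \<Gamma>)"
  define cls where "cls w = universal_cong S \<Gamma> act \<gamma>0 `` {w}" for w
  have LS: "y \<in> S" if "y \<in> L" for y
    using that L by (auto simp: gamma_left_ideal_def)
  have LI: "act s \<gamma> y \<in> L" if "s \<in> S" "\<gamma> \<in> \<Gamma>" "y \<in> L" for s \<gamma> y
    using that L by (auto simp: gamma_left_ideal_def)
  have mult: "?m (cls u) (cls v) = cls (u @ v)" if "u \<in> ?A" "v \<in> ?A" for u v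
    using universal_mult_class[OF g0 that] by (simp add: cls_def)
  have GS: "?m (universal_Gamma S \<Gamma> act \<gamma>0 \<gamma>) (universal_S S \<Gamma> act \<gamma>0 y) = cls [Inr \<gamma>, Inl y]"
    if "\<gamma> \<in> \<Gamma>" "y \<in> S" for \<gamma> y
    using mult[of "[Inr \<gamma>]" "[Inl y]"] that
    by (simp add: free_semigroup_def InlI InrI cls_def universal_Gamma_def universal_S_def)
  define W where "W = {[Inl y] | y. y \<in> L} \<union> {[Inr \<gamma>, Inl y] | \<gamma> y. \<gamma> \<in> \<Gamma> \<and> y \<in> L}"
  have T: "?T = cls ` W"
  proof -
    have "{?m (universal_Gamma S \<Gamma> act \<gamma>0 \<gamma>) (universal_S S \<Gamma> act \<gamma>0 y) | \<gamma> y. \<gamma> \<in> \<Gamma> \<and> y \<in> L}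
      = {cls [Inr \<gamma>, Inl y] | \<gamma> y. \<gamma> \<in> \<Gamma> \<and> y \<in> L}"
      using GS LS by (metis (no_types, lifting))
    moreover have "universal_S S \<Gamma> act \<gamma>0 ` L = cls ` {[Inl y] | y. y \<in> L}"
      by (auto simp: universal_S_def cls_def)
    moreover have "cls ` {[Inr \<gamma>, Inl y] | \<gamma> y. \<gamma> \<in> \<Gamma> \<and> y \<in> L}
      = {cls [Inr \<gamma>, Inl y] | \<gamma> y. \<gamma> \<in> \<Gamma> \<and> y \<in> L}"
      by blast
    ultimately show ?thesis unfolding W_def image_Un by simp
  qed
  have WA: "W \<subseteq> ?A"
    using LS by (auto simp: W_def free_semigroup_def)
  \<comment> \<open>Four cases, by the kind of letter and the shape of \<open>w\<close>. A letter of
    \<open>\<Gamma>\<close> before \<open>[Inl y]\<close> already yields a word in \<open>W\<close>;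
    the other three cases each use one defining relation.\<close>
  have letter: "cls (a # w) \<in> cls ` W" if a: "a \<in> S <+> \<Gamma>" and w: "w \<in> W" for a w
  proof -
    have S_S: "cls [Inl s, Inl y] = cls [Inl (act s \<gamma>0 y)]" if "s \<in> S" "y \<in> L" for s y
      using that universal_class_S_S[OF g0] LS by (simp add: cls_def universal_S_def)
    have S_G_S: "cls [Inl s, Inr \<gamma>, Inl y] = cls [Inl (act s \<gamma> y)]"
      if "s \<in> S" "\<gamma> \<in> \<Gamma>" "y \<in> L" for s \<gamma> y
      using that universal_class_S_Gamma_S[OF g0] LS by (simp add: cls_def universal_S_def)
    have G_G: "cls [Inr \<alpha>, Inr \<gamma>, Inl y] = cls [Inr \<alpha>, Inl y]"
      if "\<alpha> \<in> \<Gamma>" "\<gamma> \<in> \<Gamma>" "y \<in> L" for \<alpha> \<gamma> y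
      using that universal_class_Gamma_Gamma[OF g0] LS by (simp add: InlI cls_def)
    have "cls [Inl y] \<in> cls ` W" "\<gamma> \<in> \<Gamma> \<Longrightarrow> cls [Inr \<gamma>, Inl y] \<in> cls ` W" if "y \<in> L" for \<gamma> y
      using that by (auto simp: W_def)
    moreover have "(\<exists>y\<in>L. w = [Inl y]) \<or> (\<exists>\<gamma>\<in>\<Gamma>. \<exists>y\<in>L. w = [Inr \<gamma>, Inl y])"
      using w by (auto simp: W_def)
    ultimately show ?thesis
      using a by (auto simp: S_S S_G_S G_G LI g0)
  qed
  \<comment> \<open>Here \<open>u\<close> may be empty, which makes the base case of the induction
    trivial.\<close>
  have word: "cls (u @ w) \<in> cls ` W" if "u \<in> lists (S <+> \<Gamma>)" "w \<in> W" for u w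
    using that
  proof (induction u)
    case (Cons a u)
    then obtain w' where w': "w' \<in> W" "cls (u @ w) = cls w'" by auto
    have a: "[a] \<in> ?A" using Cons.hyps by (simp add: free_semigroup_def)
    have "u @ w \<in> ?A" "w' \<in> ?A"
      using Cons w' WA by (auto simp: free_semigroup_def)
    \<comment> \<open>Prepending \<open>a\<close> is multiplication by \<open>cls [a]\<close> and so
      depends only on the class of the remaining word; hence \<open>u @ w\<close> may be replaced by
      its representative \<open>w'\<close> in \<open>W\<close>.\<close>
    then have "cls (a # u @ w) = cls (a # w')"
      using mult[OF a] w'(2) by (metis append_Cons append_Nil)
    then show ?case using letter[of a w'] Cons.hyps w'(1) by simp
  qed simp
  have "W \<noteq> {}"
    using L by (auto simp: W_def gamma_left_ideal_def)
  moreover have "cls ` W \<subseteq> ?\<Sigma>"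
    using WA by (auto simp: universal_semigroup_def cls_def intro: quotientI)
  moreover have "?m X (cls w) \<in> cls ` W" if X: "X \<in> ?\<Sigma>" and w: "w \<in> W" for X w
  proof -
    obtain u where u: "u \<in> ?A" "X = cls u"
      using X by (auto simp: universal_semigroup_def cls_def elim: quotientE)
    then have "?m X (cls w) = cls (u @ w)" using mult w WA by blast
    then show ?thesis using word[of u w] u w by (simp add: free_semigroup_def)
  qed
  ultimately show ?thesis
    unfolding T left_ideal_def by blast
qed

text \<open>Left multiplication of \<open>x\<close> by the class of the word
  \<open>(s, \<gamma>)\<close> puts \<open>s \<gamma> x\<close> into \<open>M\<close>, which covers
  the left ideal of the \<Gamma>-semigroup generated by \<open>x\<close>; a further multiplication
  by elements of \<open>\<Gamma>\<close> covers the second part.\<close>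

lemma left_ideal_universal_minimal:
  assumes g0: "\<gamma>0 \<in> \<Gamma>" and x: "x \<in> S"
    and M: "left_ideal (universal_semigroup S \<Gamma> act \<gamma>0) (universal_mult S \<Gamma> act \<gamma>0) M"
      "universal_S S \<Gamma> act \<gamma>0 x \<in> M"
  shows "universal_S S \<Gamma> act \<gamma>0 ` gamma_left_ideal_gen S \<Gamma> act x
      \<union> {universal_mult S \<Gamma> act \<gamma>0 (universal_Gamma S \<Gamma> act \<gamma>0 \<gamma>) (universal_S S \<Gamma> act \<gamma>0 y) | \<gamma> y.
           \<gamma> \<in> \<Gamma> \<and> y \<in> gamma_left_ideal_gen S \<Gamma> act x} \<subseteq> M"
proof -
  have MI: "universal_mult S \<Gamma> act \<gamma>0 (universal_cong S \<Gamma> act \<gamma>0 `` {u}) Y \<in> M"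
    if "u \<in> free_semigroup (S <+> \<Gamma>)" "Y \<in> M" for u Y
    using M(1) that quotientI[OF that(1), of "universal_cong S \<Gamma> act \<gamma>0"]
    by (auto simp: left_ideal_def universal_semigroup_def)
  have "universal_S S \<Gamma> act \<gamma>0 (act s \<gamma> x) \<in> M" if "s \<in> S" "\<gamma> \<in> \<Gamma>" for s \<gamma>
  proof -
    have w: "[Inl s, Inr \<gamma>] \<in> free_semigroup (S <+> \<Gamma>)" "[Inl x] \<in> free_semigroup (S <+> \<Gamma>)"
      using that x by (auto simp: free_semigroup_def)
    show ?thesis
      using MI[OF w(1) M(2)] universal_mult_class[OF g0 w] universal_class_S_Gamma_S[OF g0 that x]
      by (simp add: universal_S_def)
  qed
  then have "universal_S S \<Gamma> act \<gamma>0 y \<in> M" if "y \<in> gamma_left_ideal_gen S \<Gamma> act x" for y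
    using that M(2) by (auto simp: gamma_left_ideal_gen_eq[OF x])
  moreover have "universal_mult S \<Gamma> act \<gamma>0 (universal_Gamma S \<Gamma> act \<gamma>0 \<gamma>) Y \<in> M"
    if "\<gamma> \<in> \<Gamma>" "Y \<in> M" for \<gamma> Y
    using MI[of "[Inr \<gamma>]"] that by (simp add: free_semigroup_def InrI universal_Gamma_def)
  ultimately show ?thesis by blast
qed

end

theorem proposition1p1:
  fixes S :: "'s set" and \<Gamma> :: "'g set" and act :: "'s \<Rightarrow> 'g \<Rightarrow> 's \<Rightarrow> 's"
    and \<gamma>0 :: 'g and x :: 's
  assumes "gamma_semigroup S \<Gamma> act"
    and "\<gamma>0 \<in> \<Gamma>"
    and "x \<in> S"
  shows "gamma_left_ideal_gen S \<Gamma> act x = {act s \<gamma> x | s \<gamma>. s \<in> S \<and> \<gamma> \<in> \<Gamma>} \<union> {x} \<and>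
    left_ideal_gen (universal_semigroup S \<Gamma> act \<gamma>0) (universal_mult S \<Gamma> act \<gamma>0)
        (universal_S S \<Gamma> act \<gamma>0 x)
      = universal_S S \<Gamma> act \<gamma>0 ` gamma_left_ideal_gen S \<Gamma> act x
        \<union> {universal_mult S \<Gamma> act \<gamma>0 (universal_Gamma S \<Gamma> act \<gamma>0 \<gamma>) (universal_S S \<Gamma> act \<gamma>0 y) | \<gamma> y.
             \<gamma> \<in> \<Gamma> \<and> y \<in> gamma_left_ideal_gen S \<Gamma> act x}"
proof -
  interpret gamma_semigroup S \<Gamma> act by fact
  note gen = gamma_left_ideal_gen_eq[OF assms(3)]
  have "gamma_left_ideal S \<Gamma> act (gamma_left_ideal_gen S \<Gamma> act x)"
    unfolding gen by (rule gamma_left_ideal_principal[OF assms(3)])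
  moreover have "x \<in> gamma_left_ideal_gen S \<Gamma> act x"
    by (simp add: gen)
  ultimately show ?thesis
    \<comment> \<open>The generated left ideal is identified as the least one containing
      \<open>x\<close>: the first lemma gives the ideal property, the second minimality.\<close>
    using left_ideal_universal left_ideal_universal_minimal assms(2,3)
    by (intro conjI gen left_ideal_gen_eqI UnI1 imageI)
qed

end
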